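(* Let $\alpha\in\mathbb Z\setminus\{0,1\}$, put $\zeta=\alpha-(\alpha-1)^2=-\alpha^2+3\alpha-1$ and $\delta=(\alpha-1)(2\alpha-1)$, and let $(h_n)$ be the sequence with $h_0=0$, $h_1=1$, $h_2=-\alpha^3\delta\zeta^4$, $h_3=-\alpha^9\delta^3\zeta^{10}$, $h_4=\alpha^{16}\delta^6\zeta^{19}$, and for $m\ge2$: $h_{2m+1}=h_{m+2}h_m^3-h_{m-1}h_{m+1}^3$, for $m\ge 3$: $h_{2m}=h_m\big(h_{m+2}h_{m-1}^2-h_{m-2}h_{m+1}^2\big)/h_2$. (i) If $n\equiv 1,9,11,19\pmod{20}$, then $h_n$ is a square. (ii) If $n\equiv 4,16\pmod{20}$, then $h_n$ is a square if and only if $-\alpha^2+3\alpha-1$ is a square. (iii) If $n\equiv 5,15\pmod{20}$, then $h_n$ is a square if and only if $\alpha$ is a square.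
   Context: The sequence defined is the elliptic divisibility sequence attached to the point $(0,0)$ of order $10$ on the curve $y^2+(\zeta^2-\zeta\delta)xy-\alpha^2\delta\zeta^4y=x^3-\delta\alpha^2x^2$ (an integral model of the Tate normal form for torsion of order 10); its tenth term is zero. Convention: an integer $m$ is called a square if $m=\pm\beta^2$ for some nonzero integer $\beta$. *)

theory Defs
  imports Complex_Main
begin

definition zeta :: "int \<Rightarrow> int" where
  "zeta \<alpha> = \<alpha> - (\<alpha> - 1)^2"

definition delta :: "int \<Rightarrow> int" where
  "delta \<alpha> = (\<alpha> - 1) * (2 * \<alpha> - 1)"

text \<open>The terms of the sequence are integers, but this is a fact to be proved. The sequence takes
  values in the rationals so that the division by its second term is exact division.\<close>

function eds10 :: "int \<Rightarrow> nat \<Rightarrow> rat" where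
  "eds10 \<alpha> n =
    (if n = 0 then 0
     else if n = 1 then 1
     else if n = 2 then of_int (- (\<alpha>^3 * delta \<alpha> * zeta \<alpha>^4))
     else if n = 3 then of_int (- (\<alpha>^9 * delta \<alpha>^3 * zeta \<alpha>^10))
     else if n = 4 then of_int (\<alpha>^16 * delta \<alpha>^6 * zeta \<alpha>^19)
     else if odd n then
       eds10 \<alpha> (n div 2 + 2) * eds10 \<alpha> (n div 2)^3
         - eds10 \<alpha> (n div 2 - 1) * eds10 \<alpha> (n div 2 + 1)^3
     else
       eds10 \<alpha> (n div 2)
         * (eds10 \<alpha> (n div 2 + 2) * eds10 \<alpha> (n div 2 - 1)^2
            - eds10 \<alpha> (n div 2 - 2) * eds10 \<alpha> (n div 2 + 1)^2)
         / eds10 \<alpha> 2)"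
  by pat_completeness auto
termination
  by (relation "measure snd") (simp_all only: wf_measure in_measure snd_conv)

declare eds10.simps [simp del]

lemma eds10_initial:
  "eds10 \<alpha> 0 = 0"
  "eds10 \<alpha> 1 = 1"
  "eds10 \<alpha> 2 = of_int (- (\<alpha>^3 * delta \<alpha> * zeta \<alpha>^4))"
  "eds10 \<alpha> 3 = of_int (- (\<alpha>^9 * delta \<alpha>^3 * zeta \<alpha>^10))"
  "eds10 \<alpha> 4 = of_int (\<alpha>^16 * delta \<alpha>^6 * zeta \<alpha>^19)"
  by (subst eds10.simps, simp)+

lemma eds10_odd:
  assumes "m \<ge> 2"
  shows "eds10 \<alpha> (2*m + 1) =
    eds10 \<alpha> (m + 2) * eds10 \<alpha> m^3 - eds10 \<alpha> (m - 1) * eds10 \<alpha> (m + 1)^3"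
  using assms by (subst eds10.simps) simp

lemma eds10_even:
  assumes "m \<ge> 3"
  shows "eds10 \<alpha> (2*m) =
    eds10 \<alpha> m * (eds10 \<alpha> (m + 2) * eds10 \<alpha> (m - 1)^2
      - eds10 \<alpha> (m - 2) * eds10 \<alpha> (m + 1)^2) / eds10 \<alpha> 2"
  using assms by (subst eds10.simps) simp

text \<open>Squares are taken up to sign, and zero is excluded. The root is always an integer,
  also when the argument is given as a rational number.\<close>

definition pm_square :: "'a::ring_1 \<Rightarrow> bool" where
  "pm_square x \<longleftrightarrow> (\<exists>\<beta>::int. \<beta> \<noteq> 0 \<and> (x = of_int (\<beta>^2) \<or> x = - of_int (\<beta>^2)))"

end

theory Submission
  imports Defs
begin

text \<open>Since the point has order 10, the sequence is determined by its terms up to index 5 together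
  with the single multiplier \<open>\<omega> = h\<^sub>6 / h\<^sub>4\<close>: one has
  \<open>h\<^bsub>10k+r\<^esub> = (-1)\<^sup>k \<omega>\<^bsup>kr+5k\<^sup>2\<^esup> h\<^sub>r\<close> and \<open>h\<^bsub>10-r\<^esub> = \<omega>\<^bsup>5-r\<^esup> h\<^sub>r\<close>.
  The right-hand side is compatible with both duplication formulas, because the exponents of \<open>\<omega>\<close> and
  the signs agree in all three terms of each formula; hence the formulas need only be checked for
  one representative of \<open>m\<close> modulo 10. As \<open>h\<^sub>4 = \<alpha>\<^bsup>16\<^esup>\<delta>\<^sup>6\<zeta>\<^bsup>19\<^esup>\<close> and \<open>h\<^sub>5 = \<alpha>\<^bsup>25\<^esup>\<delta>\<^bsup>10\<^esup>\<zeta>\<^bsup>30\<^esup>\<close>,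
  the parity of the exponents decides which terms are squares.\<close>

section \<open>The quasi-periodic closed form\<close>

definition torsion10_seq :: "'a::comm_ring_1 \<Rightarrow> 'a \<Rightarrow> 'a \<Rightarrow> 'a \<Rightarrow> 'a \<Rightarrow> nat \<Rightarrow> 'a" where
  "torsion10_seq w x y u v n =
    (-1)^(n div 10) * w^((n div 10) * (n mod 10) + 5 * (n div 10)^2)
      * ([0, 1, x, y, u, v, w * u, w^2 * y, w^3 * x, w^4] ! (n mod 10))"

text \<open>Here \<open>s\<close> need not be reduced: for \<open>s = 10 * j + t\<close>, the cross
  term \<open>10 * k * j\<close> of \<open>5 * (k + j)^2\<close> is exactly what
  \<open>k * s\<close> has beyond \<open>k * t\<close>.\<close>

lemma torsion10_seq_add:
  "torsion10_seq w x y u v (10 * k + s) =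
    (-1)^k * w^(k * s + 5 * k^2) * torsion10_seq w x y u v s"
proof -
  define j t where "j = s div 10" and "t = s mod 10"
  have s: "s = 10 * j + t" by (simp add: j_def t_def)
  have "(10 * k + s) div 10 = k + j" "(10 * k + s) mod 10 = t"
    by (simp_all add: j_def t_def)
  moreover have "(k + j) * t + 5 * (k + j)^2 = (k * s + 5 * k^2) + (j * t + 5 * j^2)"
    unfolding s by (simp add: algebra_simps power2_eq_square)
  ultimately show ?thesis
    unfolding torsion10_seq_def by (simp add: power_add j_def t_def ac_simps)
qed

text \<open>Representatives from 2 to 11, rather than 0 to 9, keep \<open>r - 1\<close> and
  \<open>r - 2\<close> from being truncated.\<close>

lemma nat_ge2_decomp10:
  fixes m :: nat
  assumes "m \<ge> 2"
  obtains k r where "m = 10 * k + r" "r \<in> {2,3,4,5,6,7,8,9,10,11}"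
proof
  show "m = 10 * ((m - 2) div 10) + ((m - 2) mod 10 + 2)"
    using assms by simp
  have "j < 10 \<Longrightarrow> j + 2 \<in> {2,3,4,5,6,7,8,9,10,11}" for j :: nat
    unfolding insert_iff empty_iff by presburger
  then show "(m - 2) mod 10 + 2 \<in> {2,3,4,5,6,7,8,9,10,11}"
    by simp
qed

text \<open>The duplication formulas at the indices 5 to 9 on the table entries; at 6 and 8 the
  division by the second term \<open>x\<close> is cleared.\<close>

locale torsion10_relations =
  fixes w x y u v :: "'a::idom"
  assumes rel5: "v = u * x^3 - y^3"
    and rel6: "w * u * x = y * (v * x^2 - u^2)"
    and rel7: "w^2 * y = v * y^3 - x * u^3"
    and rel8: "w^3 * x^2 = u * (w * u * y^2 - x * v^2)"
    and rel9: "w^4 = w * u^4 - y * v^3"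
begin

abbreviation h :: "nat \<Rightarrow> 'a" where
  "h \<equiv> torsion10_seq w x y u v"

text \<open>By the symmetry of the table, \<open>r\<close> and \<open>9 - r\<close> follow from the
  same relation. From \<open>r = 8\<close> on, one product contains \<open>h 10 = 0\<close> and only
  powers of \<open>w\<close> are compared.\<close>

lemma odd_representatives:
  "r \<in> {2,3,4,5,6,7,8,9,10,11} \<Longrightarrow>
    h (2 * r + 1) = h (r + 2) * h r^3 - h (r - 1) * h (r + 1)^3"
  apply (elim insertE emptyE; hypsubst_thin; simp add: torsion10_seq_def)
       apply (rule rel5)
      apply (rule rel7)
     apply (use rel9 in algebra)
    apply (use rel9 in algebra)
   apply (use rel7 in algebra)
  apply (use rel5 in algebra)
  done

text \<open>Now \<open>r\<close> and \<open>10 - r\<close> correspond: \<open>rel6\<close> serves 3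
  and 7, \<open>rel8\<close> serves 4 and 6. At \<open>r = 5\<close> the two products cancel,
  matching \<open>h 10 = 0\<close>.\<close>

lemma even_representatives:
  "r \<in> {2,3,4,5,6,7,8,9,10,11} \<Longrightarrow>
    h (2 * r) * h 2 = h r * (h (r + 2) * h (r - 1)^2 - h (r - 2) * h (r + 1)^2)"
  apply (elim insertE emptyE; hypsubst_thin; simp add: torsion10_seq_def power_mult_distrib)
      apply (rule rel6)
     apply (use rel8 in algebra)
    apply (use rel8 in algebra)
   apply (use rel6 in algebra)
  apply algebra+
  done

text \<open>Every product in the duplication formulas has this shape. Its four signs cancel, and the
  power of \<open>w\<close> depends on the indices only through the weight \<open>t\<close>.\<close>

lemma shifted_product:
  assumes "s1 + s2 + 2 * s3 = t"
  shows "h (10 * k + s1) * h (10 * k + s2) * h (10 * k + s3)^2 =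
    w^(k * t + 20 * k^2) * (h s1 * h s2 * h s3^2)"
proof -
  define A B C where "A = k * s1 + 5 * k^2" and "B = k * s2 + 5 * k^2" and "C = k * s3 + 5 * k^2"
  have "k * t + 20 * k^2 = A + B + C * 2"
    by (simp add: A_def B_def C_def assms[symmetric] algebra_simps)
  then have w: "w^(k * t + 20 * k^2) = w^A * w^B * (w^C)^2"
    by (simp only: power_add power_mult)
  have "((-1)^k :: 'a)^2 = 1"
    by (simp flip: power_mult)
  moreover have "c^2 = 1 \<Longrightarrow> c * a1 * p * (c * a2 * q) * (c * a3 * r)^2 = a1 * a2 * a3^2 * (p * q * r^2)"
    for c a1 a2 a3 p q r :: 'a
    by algebra
  ultimately show ?thesis
    unfolding torsion10_seq_add w by (simp only: A_def B_def C_def)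
qed

lemma odd_recurrence:
  assumes "m \<ge> 2"
  shows "h (2 * m + 1) = h (m + 2) * h m^3 - h (m - 1) * h (m + 1)^3"
proof -
  obtain k r where m: "m = 10 * k + r" and r: "r \<in> {2,3,4,5,6,7,8,9,10,11}"
    using nat_ge2_decomp10[OF assms] .
  have "r \<ge> 2" using r by auto
  \<comment> \<open>Both products have weight \<open>4 * r + 2\<close>, and shifting
    \<open>2 * r + 1\<close> by \<open>10 * (2 * k)\<close> gives the same power of \<open>w\<close>
    with sign 1.\<close>
  define e where "e = k * (4 * r + 2) + 20 * k^2"
  have "h (2 * m + 1) = h (10 * (2 * k) + (2 * r + 1))"
    by (simp add: m algebra_simps)
  also have "\<dots> = w^e * h (2 * r + 1)"
    unfolding torsion10_seq_add by (simp add: e_def algebra_simps power2_eq_square)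
  also have "\<dots> = w^e * (h (r + 2) * h r * h r^2) - w^e * (h (r - 1) * h (r + 1) * h (r + 1)^2)"
    unfolding odd_representatives[OF r] by algebra
  also have "\<dots> = h (10 * k + (r + 2)) * h (10 * k + r) * h (10 * k + r)^2
      - h (10 * k + (r - 1)) * h (10 * k + (r + 1)) * h (10 * k + (r + 1))^2"
    unfolding e_def using \<open>r \<ge> 2\<close> by (subst (1 2) shifted_product[where t = "4 * r + 2"]) auto
  also have "\<dots> = h (m + 2) * h m^3 - h (m - 1) * h (m + 1)^3"
    using \<open>r \<ge> 2\<close> by (simp add: m power3_eq_cube power2_eq_square mult.assoc add.assoc)
  finally show ?thesis .
qed

lemma even_recurrence:
  assumes "m \<ge> 2"
  shows "h (2 * m) * h 2 = h m * (h (m + 2) * h (m - 1)^2 - h (m - 2) * h (m + 1)^2)"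
proof -
  obtain k r where m: "m = 10 * k + r" and r: "r \<in> {2,3,4,5,6,7,8,9,10,11}"
    using nat_ge2_decomp10[OF assms] .
  have "r \<ge> 2" using r by auto
  \<comment> \<open>The common weight is now \<open>4 * r\<close>; the factor \<open>h 2\<close>
    stays unshifted.\<close>
  define e where "e = k * (4 * r) + 20 * k^2"
  have "h (2 * m) * h 2 = h (10 * (2 * k) + 2 * r) * h 2"
    by (simp add: m algebra_simps)
  also have "\<dots> = w^e * (h (2 * r) * h 2)"
    unfolding torsion10_seq_add by (simp add: e_def algebra_simps power2_eq_square)
  also have "\<dots> = w^e * (h r * h (r + 2) * h (r - 1)^2) - w^e * (h r * h (r - 2) * h (r + 1)^2)"
    unfolding even_representatives[OF r] by algebra
  also have "\<dots> = h (10 * k + r) * h (10 * k + (r + 2)) * h (10 * k + (r - 1))^2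
      - h (10 * k + r) * h (10 * k + (r - 2)) * h (10 * k + (r + 1))^2"
    unfolding e_def using \<open>r \<ge> 2\<close> by (subst (1 2) shifted_product[where t = "4 * r"]) auto
  also have "\<dots> = h m * (h (m + 2) * h (m - 1)^2 - h (m - 2) * h (m + 1)^2)"
    using \<open>r \<ge> 2\<close> by (simp add: m right_diff_distrib mult.assoc add.assoc)
  finally show ?thesis .
qed

end

section \<open>Squares up to sign\<close>

lemma pm_square_minus: "pm_square (- x) \<longleftrightarrow> pm_square x" for x :: "'a::ring_1"
  unfolding pm_square_def by (metis minus_minus)

lemma pm_square_of_int_rat: "pm_square (of_int x :: rat) \<longleftrightarrow> pm_square x"
  unfolding pm_square_def
  by (simp only: of_int_minus[symmetric] of_int_eq_iff of_int_eq_id id_apply)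

lemma pm_square_mult_square:
  fixes c s :: int
  assumes "c \<noteq> 0"
  shows "pm_square (c^2 * s) \<longleftrightarrow> pm_square s"
proof -
  have *: "(\<exists>\<beta>::int. \<beta> \<noteq> 0 \<and> c^2 * t = \<beta>^2) \<longleftrightarrow> (\<exists>\<beta>. \<beta> \<noteq> 0 \<and> t = \<beta>^2)" for t
  proof
    assume "\<exists>\<beta>::int. \<beta> \<noteq> 0 \<and> c^2 * t = \<beta>^2"
    then obtain \<beta> where b: "\<beta> \<noteq> 0" "c^2 * t = \<beta>^2" by blast
    then have "c^2 dvd \<beta>^2" by (metis dvd_triv_left)
    then have "c dvd \<beta>" by simp
    then obtain g where "\<beta> = c * g" ..
    with b assms show "\<exists>\<beta>. \<beta> \<noteq> 0 \<and> t = \<beta>^2"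
      by (intro exI[of _ g]) (simp add: power_mult_distrib)
  next
    assume "\<exists>\<beta>. \<beta> \<noteq> 0 \<and> t = \<beta>^2"
    then obtain g where "g \<noteq> 0" "t = g^2" by blast
    with assms show "\<exists>\<beta>::int. \<beta> \<noteq> 0 \<and> c^2 * t = \<beta>^2"
      by (intro exI[of _ "c * g"]) (simp add: power_mult_distrib)
  qed
  \<comment> \<open>The two signs are treated separately, as the cases \<open>s\<close> and
    \<open>- s\<close> of the claim above.\<close>
  have "pm_square t \<longleftrightarrow> (\<exists>\<beta>. \<beta> \<noteq> 0 \<and> t = \<beta>^2) \<or> (\<exists>\<beta>. \<beta> \<noteq> 0 \<and> - t = \<beta>^2)" for t :: int
    unfolding pm_square_def by (auto simp: minus_equation_iff eq_commute)
  with *[of s] *[of "- s"] show ?thesis by simp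
qed

text \<open>Meant for \<open>e\<close> from the shift by \<open>10 * k\<close> and \<open>f\<close>
  from the table entry: an even total exponent makes the power of \<open>w\<close> a nonzero
  square.\<close>

lemma pm_square_mult_even_power:
  fixes w t :: int
  assumes "w \<noteq> 0" "even (e + f)"
  shows "pm_square ((-1)^k * w^e * (w^f * t)) \<longleftrightarrow> pm_square t"
proof -
  obtain g where "e + f = 2 * g" using assms(2) by blast
  then have "w^e * w^f = (w^g)^2"
    by (simp add: mult.commute flip: power_add power_mult)
  then have "(-1)^k * w^e * (w^f * t) = (-1)^k * ((w^g)^2 * t)"
    by (simp only: mult.assoc flip: \<open>w^e * w^f = (w^g)^2\<close>)
  moreover have "pm_square ((-1)^k * s) \<longleftrightarrow> pm_square s" for s :: int
    by (cases "even k") (simp_all add: pm_square_minus)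
  moreover have "pm_square ((w^g)^2 * t) \<longleftrightarrow> pm_square t"
    using assms(1) by (intro pm_square_mult_square) simp
  ultimately show ?thesis by (simp only:)
qed

section \<open>Identification of the sequence with the closed form\<close>

lemma zeta_nonzero: "zeta \<alpha> \<noteq> 0"
proof
  assume "zeta \<alpha> = 0"
  then have "\<alpha> * (3 - \<alpha>) = 1" by (simp add: zeta_def algebra_simps power2_eq_square)
  \<comment> \<open>Integer factors of 1 are equal, which would give
    \<open>2 * \<alpha> = 3\<close>.\<close>
  then show False by (auto simp: zmult_eq_1_iff)
qed

lemma delta_nonzero: "\<alpha> \<noteq> 1 \<Longrightarrow> delta \<alpha> \<noteq> 0"
  unfolding delta_def mult_eq_0_iff by presburger

text \<open>With \<open>a = \<alpha>\<close>, \<open>b = \<alpha> - 1\<close>,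
  \<open>d = delta \<alpha>\<close> and \<open>z = zeta \<alpha>\<close>, each relation is a
  monomial times the premise of the same number, so no high power of a polynomial has to be
  expanded.\<close>

lemma torsion10_relationsI:
  fixes a b d z :: "'a::idom"
  assumes r5: "d = a^2 - z" and r6: "a = b + 1" and r7: "b^2 = a - z"
    and r8: "d = b * (a^2 - b^2)" and r9: "b^4 = d - a * b * z"
  shows "torsion10_relations (- (b * a^21 * d^8 * z^25))
    (- (a^3 * d * z^4)) (- (a^9 * d^3 * z^10)) (a^16 * d^6 * z^19) (a^25 * d^10 * z^30)"
  apply unfold_locales
      apply (use r5 in algebra)
     apply (use r6 in algebra)
    apply (use r7 in algebra)
   apply (use r8 in algebra)
  apply (use r9 in algebra)
  done

text \<open>The quotient of the sixth by the fourth term, found by solving the duplication formula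
  at index 6.\<close>

definition multiplier :: "int \<Rightarrow> int" where
  "multiplier \<alpha> = - ((\<alpha> - 1) * \<alpha>^21 * delta \<alpha>^8 * zeta \<alpha>^25)"

definition eds10_int :: "int \<Rightarrow> nat \<Rightarrow> int" where
  "eds10_int \<alpha> = torsion10_seq (multiplier \<alpha>)
    (- (\<alpha>^3 * delta \<alpha> * zeta \<alpha>^4)) (- (\<alpha>^9 * delta \<alpha>^3 * zeta \<alpha>^10))
    (\<alpha>^16 * delta \<alpha>^6 * zeta \<alpha>^19) (\<alpha>^25 * delta \<alpha>^10 * zeta \<alpha>^30)"

lemma eds10_eq_eds10_int:
  assumes "\<alpha> \<notin> {0, 1}"
  shows "eds10 \<alpha> n = of_int (eds10_int \<alpha> n)"
proof (induction n rule: less_induct)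
  case (less n)
  interpret torsion10_relations "multiplier \<alpha>"
    "- (\<alpha>^3 * delta \<alpha> * zeta \<alpha>^4)" "- (\<alpha>^9 * delta \<alpha>^3 * zeta \<alpha>^10)"
    "\<alpha>^16 * delta \<alpha>^6 * zeta \<alpha>^19" "\<alpha>^25 * delta \<alpha>^10 * zeta \<alpha>^30"
    unfolding multiplier_def
    by (rule torsion10_relationsI; (unfold delta_def zeta_def)?; algebra)
  \<comment> \<open>The bounds on \<open>m\<close> make \<open>m + 2\<close>, the largest index on
    the right of each recurrence, smaller than \<open>n\<close>.\<close>
  consider "n \<in> {0, 1, 2, 3, 4}" | m where "m \<ge> 2" "n = 2 * m + 1" | m where "m \<ge> 3" "n = 2 * m"
  proof (cases "n < 5")
    case True
    then have "n \<in> {0, 1, 2, 3, 4}" by auto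
    then show ?thesis by (rule that)
  next
    case False
    show ?thesis
    proof (cases "even n")
      case True
      with False show ?thesis by (intro that(3)[of "n div 2"]) auto
    next
      case odd: False
      with False show ?thesis by (intro that(2)[of "n div 2"]) auto
    qed
  qed
  then show ?case
  proof cases
    case 1
    then show ?thesis
      by (elim insertE emptyE) (simp_all add: eds10_initial eds10_initial[simplified]
          eds10_int_def torsion10_seq_def del: of_int_minus of_int_mult of_int_power)
  next
    case (2 m)
    then show ?thesis
      unfolding eds10_int_def
      by (simp only: eds10_odd odd_recurrence of_int_diff of_int_mult of_int_power)
        (simp add: less.IH eds10_int_def)
  next
    case (3 m)
    \<comment> \<open>The closed form satisfies the even recurrence multiplied by its second term;
      nonvanishing permits the division.\<close>
    have "eds10 \<alpha> 2 \<noteq> 0"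
      using assms zeta_nonzero delta_nonzero by (simp add: eds10_initial)
    moreover have "of_int (h (2 * m)) * eds10 \<alpha> 2 =
      eds10 \<alpha> m * (eds10 \<alpha> (m + 2) * eds10 \<alpha> (m - 1)^2 - eds10 \<alpha> (m - 2) * eds10 \<alpha> (m + 1)^2)"
      using 3 less.IH even_recurrence[of m, THEN arg_cong[where f = rat_of_int]]
      by (simp add: eds10_int_def)
    ultimately show ?thesis
      unfolding 3(2) eds10_even[OF 3(1)] eds10_int_def by (metis nonzero_mult_div_cancel_right)
  qed
qed

text \<open>Modulo 2 the exponent is \<open>k * (r + 1) + f\<close>: for odd \<open>r\<close> and
  even \<open>f\<close> it is always even, while for even \<open>r\<close> the parity of
  \<open>k\<close> matters, whence residues modulo 20.\<close>

lemma pm_square_eds10_shift: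
  assumes "\<alpha> \<notin> {0, 1}" and "eds10_int \<alpha> r = multiplier \<alpha>^f * t" and "even (k * r + 5 * k^2 + f)"
  shows "pm_square (eds10 \<alpha> (10 * k + r)) \<longleftrightarrow> pm_square t"
proof -
  have "multiplier \<alpha> \<noteq> 0"
    using assms(1) zeta_nonzero delta_nonzero by (simp add: multiplier_def)
  then show ?thesis
    unfolding eds10_eq_eds10_int[OF assms(1)] pm_square_of_int_rat
    unfolding eds10_int_def torsion10_seq_add assms(2)[unfolded eds10_int_def]
    using assms(3) by (rule pm_square_mult_even_power)
qed

section \<open>Square terms by residue modulo 20\<close>

theorem theorem5p19:
  fixes \<alpha> :: int and n :: nat
  assumes "\<alpha> \<notin> {0, 1}"
  shows "(n mod 20 \<in> {1, 9, 11, 19} \<longrightarrow> pm_square (eds10 \<alpha> n)) \<and>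
         (n mod 20 \<in> {4, 16} \<longrightarrow> (pm_square (eds10 \<alpha> n) \<longleftrightarrow> pm_square (- (\<alpha>^2) + 3 * \<alpha> - 1))) \<and>
         (n mod 20 \<in> {5, 15} \<longrightarrow> (pm_square (eds10 \<alpha> n) \<longleftrightarrow> pm_square \<alpha>))"
proof -
  define k where "k = n div 10"
  have n: "n = 10 * k + n mod 10" and "n mod 10 < 10"
    by (simp_all add: k_def)
  have "n mod 20 = 10 * (k mod 2) + n mod 10"
    using mod_mult2_eq[of n 10 2] by (simp add: k_def)
  then have mod20: "n mod 20 = (if even k then n mod 10 else 10 + n mod 10)"
    by (simp add: even_iff_mod_2_eq_zero odd_iff_mod_2_eq_one)
  have one: "pm_square (1 :: int)"
    unfolding pm_square_def by (intro exI[of _ 1]) simp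
  have nz: "\<alpha> \<noteq> 0" "zeta \<alpha> \<noteq> 0" "delta \<alpha> \<noteq> 0"
    using assms zeta_nonzero delta_nonzero by auto
  have four: "pm_square (\<alpha>^16 * delta \<alpha>^6 * zeta \<alpha>^19) \<longleftrightarrow> pm_square (- (\<alpha>^2) + 3 * \<alpha> - 1)"
  proof -
    have "\<alpha>^16 * delta \<alpha>^6 * zeta \<alpha>^19 = (\<alpha>^8 * delta \<alpha>^3 * zeta \<alpha>^9)^2 * zeta \<alpha>"
      by algebra
    moreover have "zeta \<alpha> = - (\<alpha>^2) + 3 * \<alpha> - 1"
      unfolding zeta_def by algebra
    ultimately show ?thesis using nz by (simp add: pm_square_mult_square)
  qed
  have five: "pm_square (\<alpha>^25 * delta \<alpha>^10 * zeta \<alpha>^30) \<longleftrightarrow> pm_square \<alpha>"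
  proof -
    have "\<alpha>^25 * delta \<alpha>^10 * zeta \<alpha>^30 = (\<alpha>^12 * delta \<alpha>^5 * zeta \<alpha>^15)^2 * \<alpha>"
      by algebra
    then show ?thesis using nz by (simp add: pm_square_mult_square)
  qed
  note shift = pm_square_eds10_shift[OF assms, of _ _ _ k]
  have "pm_square (eds10 \<alpha> n)" if "n mod 20 \<in> {1, 9, 11, 19}"
  proof -
    have "n mod 10 = 1 \<or> n mod 10 = 9"
      using that mod20 \<open>n mod 10 < 10\<close> by (auto split: if_splits)
    with n have "n = 10 * k + 1 \<or> n = 10 * k + 9" by metis
    then consider "n = 10 * k + 1" | "n = 10 * k + 9" by blast
    then show ?thesis
    proof cases
      case 1
      then show ?thesis
        using one shift[of 1 0 1] by (simp add: eds10_int_def torsion10_seq_def)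
    next
      \<comment> \<open>The ninth table entry is the fourth power of the multiplier, with cofactor
        1.\<close>
      case 2
      then show ?thesis
        using one shift[of 9 4 1] by (simp add: eds10_int_def torsion10_seq_def)
    qed
  qed
  moreover have "pm_square (eds10 \<alpha> n) \<longleftrightarrow> pm_square (- (\<alpha>^2) + 3 * \<alpha> - 1)"
    if "n mod 20 \<in> {4, 16}"
  proof -
    have "n mod 10 = 4 \<and> even k \<or> n mod 10 = 6 \<and> odd k"
      using that mod20 \<open>n mod 10 < 10\<close> by (auto split: if_splits)
    with n have "n = 10 * k + 4 \<and> even k \<or> n = 10 * k + 6 \<and> odd k" by metis
    then consider "n = 10 * k + 4" "even k" | "n = 10 * k + 6" "odd k" by blast
    then show ?thesis
    proof cases
      case 1
      then show ?thesis
        using shift[of 4 0 "\<alpha>^16 * delta \<alpha>^6 * zeta \<alpha>^19"] four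
        by (simp add: eds10_int_def torsion10_seq_def)
    \<comment> \<open>In the remaining case the sixth table entry is the multiplier times the
      fourth; the odd \<open>k\<close> makes up for this extra factor.\<close>
    next
      case 2
      then show ?thesis
        using shift[of 6 1 "\<alpha>^16 * delta \<alpha>^6 * zeta \<alpha>^19"] four
        by (simp add: eds10_int_def torsion10_seq_def)
    qed
  qed
  moreover have "pm_square (eds10 \<alpha> n) \<longleftrightarrow> pm_square \<alpha>" if "n mod 20 \<in> {5, 15}"
  proof -
    have "n mod 10 = 5"
      using that mod20 \<open>n mod 10 < 10\<close> by (auto split: if_splits)
    with n have "n = 10 * k + 5" by metis
    then show ?thesis
      using shift[of 5 0 "\<alpha>^25 * delta \<alpha>^10 * zeta \<alpha>^30"] five
      by (simp add: eds10_int_def torsion10_seq_def)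
  qed
  ultimately show ?thesis by (intro conjI impI)
qed

end
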